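(* Let $\Gamma$ be a (directed or undirected) strongly regular graph with parameter set $(n,k,t,\lambda,\mu)$. Let $a$ and $b$ be positive integers with $ab=n$, and suppose there exists a homogeneous partition $\pi=\{C_1,\ldots,C_a\}$ of $V(\Gamma)$ into $a$ cells of size $b$ which is column equitable with quotient matrix $Q=(\lambda+b-k)I+\mu(J-I)$ (here $I$ and $J$ are the $a\times a$ identity and all-ones matrices). Then for every positive integer $j$, the $\pi$-join $\Gamma^j_\pi$ of $\Gamma$ in power $j$ is a directed strongly regular graph with parameter set $$\big((ja+1)n,\; jn+k,\; jb+t,\; jb+\lambda,\; jb+\mu\big).$$
   Context: All graphs are finite, without loops or multiple arcs; an undirected edge is regarded as a pair of opposite arcs. A directed strongly regular graph (DSRG) with parameters $(n,k,t,\lambda,\mu)$ is a digraph on $n$ vertices whose adjacency matrix $A$ (a $0/1$ matrix with zero diagonal) satisfies $AJ=JA=kJ$ and $A^2=tI+\lambda A+\mu(J-I-A)$; equivalently every vertex has in- and outdegree $k$, is incident with $t$ undirected edges, and the number of directed 2-paths from $x$ to $y\neq x$ is $\lambda$ if $x\to y$ is an arc and $\mu$ otherwise. An undirected strongly regular graph with parameters $(n,k,\lambda,\mu)$ is regarded as a DSRG with parameters $(n,k,k,\lambda,\mu)$. A partition $\pi=\{C_1,\dots,C_a\}$ of the vertex set is homogeneous of degree $b$ if every cell has exactly $b$ vertices. It is column equitable with quotient matrix $Q=(q_{i,l})$ if for all $i,l$ and every vertex $v\in C_l$ the number of arcs from vertices of $C_i$ to $v$ equals $q_{i,l}$ (independent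 of the choice of $v\in C_l$). The $\pi$-join of $\Gamma$ in power $j$ (for a homogeneous partition $\pi=\{C_1,\dots,C_a\}$ and positive integer $j$) is the digraph $\Gamma^j_\pi$ with vertex set $V(\Gamma)\times\{0,1,\ldots,ja\}$ and the following arcs: $(u,r)\to(v,r)$ whenever $u\to v$ is an arc of $\Gamma$; and for every vertex $(u,r)$, every $i\in\{1,\ldots,a\}$ and every $m\in\{1,\ldots,j\}$, arcs from $(u,r)$ to all vertices $(v,r')$ with $v\in C_i$ and $r'\equiv r+(i-1)j+m \pmod{ja+1}$. There are no other arcs. *)

theory Defs
  imports "Graph_Theory.Pair_Digraph" "HOL-Library.Disjoint_Sets" "HOL-Number_Theory.Cong"
begin

text \<open>
  A digraph is a \<^typ>\<open>'v pair_pre_digraph\<close> satisfying \<^locale>\<open>pair_digraph\<close> (finite, loopless, no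
  parallel arcs); an undirected edge is a pair of opposite arcs.  Matrices whose rows and columns
  are indexed by a finite set \<open>V\<close> are represented by integer-valued functions of two arguments, of
  which only the values on \<open>V\<close> are relevant.
\<close>

definition id_mat :: "'i \<Rightarrow> 'i \<Rightarrow> int" where
  "id_mat x y = (if x = y then 1 else 0)"

definition ones_mat :: "'i \<Rightarrow> 'i \<Rightarrow> int" where
  "ones_mat x y = 1"

definition mat_mul :: "'i set \<Rightarrow> ('i \<Rightarrow> 'i \<Rightarrow> int) \<Rightarrow> ('i \<Rightarrow> 'i \<Rightarrow> int) \<Rightarrow> 'i \<Rightarrow> 'i \<Rightarrow> int" where
  "mat_mul V M N x y = (\<Sum>z\<in>V. M x z * N z y)"

definition adj_mat :: "'v pair_pre_digraph \<Rightarrow> 'v \<Rightarrow> 'v \<Rightarrow> int" where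
  "adj_mat G x y = (if (x, y) \<in> parcs G then 1 else 0)"

text \<open>
  The parameters are \<open>(n, k, t, \<lambda>, \<mu>)\<close>.  An undirected strongly regular graph with parameters
  \<open>(n, k, \<lambda>, \<mu>)\<close> is the case \<open>t = k\<close>.
\<close>

definition dsrg :: "'v pair_pre_digraph \<Rightarrow> nat \<Rightarrow> nat \<Rightarrow> nat \<Rightarrow> nat \<Rightarrow> nat \<Rightarrow> bool" where
  "dsrg G n k t lam mu \<longleftrightarrow>
     pair_digraph G \<and> card (pverts G) = n \<and>
     (let V = pverts G; A = adj_mat G in
       \<forall>x\<in>V. \<forall>y\<in>V.
         mat_mul V A ones_mat x y = int k * ones_mat x y \<and>
         mat_mul V ones_mat A x y = int k * ones_mat x y \<and>
         mat_mul V A A x y =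
           int t * id_mat x y + int lam * A x y + int mu * (ones_mat x y - id_mat x y - A x y))"

text \<open>
  The cells carry indices \<open>1, \<dots>, a\<close>, since both the quotient matrix and the \<open>\<pi>\<close>-join refer to
  them; injectivity makes the indexed cells pairwise distinct.
\<close>

definition homogeneous_partition ::
    "'v pair_pre_digraph \<Rightarrow> nat \<Rightarrow> nat \<Rightarrow> (nat \<Rightarrow> 'v set) \<Rightarrow> bool" where
  "homogeneous_partition G a b C \<longleftrightarrow>
     partition_on (pverts G) (C ` {1..a}) \<and> inj_on C {1..a} \<and> (\<forall>i\<in>{1..a}. card (C i) = b)"

definition column_equitable ::
    "'v pair_pre_digraph \<Rightarrow> nat \<Rightarrow> (nat \<Rightarrow> 'v set) \<Rightarrow> (nat \<Rightarrow> nat \<Rightarrow> int) \<Rightarrow> bool" where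
  "column_equitable G a C Q \<longleftrightarrow>
     (\<forall>i\<in>{1..a}. \<forall>l\<in>{1..a}. \<forall>v\<in>C l. int (card {u \<in> C i. (u, v) \<in> parcs G}) = Q i l)"

definition pi_join ::
    "'v pair_pre_digraph \<Rightarrow> nat \<Rightarrow> (nat \<Rightarrow> 'v set) \<Rightarrow> nat \<Rightarrow> ('v \<times> nat) pair_pre_digraph" where
  "pi_join G a C j =
     \<lparr> pverts = pverts G \<times> {0..j * a},
       parcs =
         {((u, r), (v, r)) | u v r. (u, v) \<in> parcs G \<and> r \<in> {0..j * a}} \<union>
         {((u, r), (v, r')) | u r v r' i m.
            u \<in> pverts G \<and> r \<in> {0..j * a} \<and> r' \<in> {0..j * a} \<and>
            i \<in> {1..a} \<and> m \<in> {1..j} \<and> v \<in> C i \<and>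
            [r' = r + (i - 1) * j + m] (mod (j * a + 1))} \<rparr>"

end

theory Submission
  imports Defs
begin

text \<open>
  For \<open>r \<noteq> s\<close> all arcs from layer \<open>r\<close> to layer \<open>s\<close> of the join enter a single cell \<open>C i\<close>, where
  \<open>i = join_cell a j r s\<close>, and for fixed \<open>s\<close> each \<open>i\<close> arises from exactly \<open>j\<close> layers \<open>r\<close>.  Now count
  2-paths from \<open>(u, r)\<close> to \<open>(w, s)\<close>, with \<open>w \<in> C l\<close>, by the layer of the middle vertex.  A layer
  other than \<open>r\<close> and \<open>s\<close> contributes \<open>b\<close> if its arcs to layer \<open>s\<close> enter \<open>C l\<close>, and \<open>0\<close> otherwise.
  If \<open>r = s\<close>, this gives \<open>j b\<close> in addition to the 2-paths of \<open>G\<close> itself.  If \<open>r \<noteq> s\<close> and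
  \<open>i = join_cell a j r s\<close>, layer \<open>r\<close> contributes \<open>k\<close> if \<open>i = l\<close> and \<open>0\<close> otherwise, layer \<open>s\<close>
  contributes \<open>Q i l\<close>, and the remaining layers contribute \<open>b (j - [i = l])\<close>; the quotient matrix is
  exactly the one for which the sum is \<open>j b + \<lambda>\<close> or \<open>j b + \<mu>\<close>.
\<close>

text \<open>The residue of \<open>s - r\<close> modulo \<open>j * a + 1\<close>, when nonzero, is an
  offset in \<open>1..j * a\<close>; these offsets split into blocks of \<open>j\<close> consecutive
  values, one block per cell. Adding the modulus keeps the natural subtraction exact for layers
  \<open>r \<le> j * a\<close>. For \<open>r = s\<close> the value is a meaningless 1.\<close>

definition join_cell :: "nat \<Rightarrow> nat \<Rightarrow> nat \<Rightarrow> nat \<Rightarrow> nat" where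
  "join_cell a j r s = ((s + (j * a + 1) - r) mod (j * a + 1) - 1) div j + 1"

lemma cong_shift_iff:
  fixes r s d N :: nat
  assumes "r < N" "s < N" "d < N"
  shows "[s = r + d] (mod N) \<longleftrightarrow> d = (s + N - r) mod N"
proof -
  have "[s = r + d] (mod N) \<longleftrightarrow> [r + (s + N - r) = r + d] (mod N)"
    using assms by (simp add: cong_def)
  also have "\<dots> \<longleftrightarrow> [s + N - r = d] (mod N)"
    by (rule cong_add_lcancel_nat)
  finally show ?thesis using assms by (auto simp: cong_def)
qed

text \<open>Division by \<open>j\<close> with remainders taken in \<open>1..j\<close> instead of
  \<open>0..j - 1\<close>, hence the \<open>d - 1\<close>; \<open>0 < d\<close> rules out truncation
  there.\<close>

lemma shift_iff_div:
  fixes d i j :: nat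
  assumes "1 \<le> i" "0 < j"
  shows "(\<exists>m\<in>{1..j}. d = (i - 1) * j + m) \<longleftrightarrow> 0 < d \<and> (d - 1) div j + 1 = i"
proof
  assume "\<exists>m\<in>{1..j}. d = (i - 1) * j + m"
  then obtain m where m: "1 \<le> m" "m \<le> j" "d = (i - 1) * j + m" by auto
  then have "d - 1 = (i - 1) * j + (m - 1)" "m - 1 < j" by auto
  then have "(d - 1) div j = i - 1" using assms by (simp add: div_add1_eq)
  then show "0 < d \<and> (d - 1) div j + 1 = i" using m assms by auto
next
  assume d: "0 < d \<and> (d - 1) div j + 1 = i"
  then have "d = (i - 1) * j + ((d - 1) mod j + 1)"
    using div_mult_mod_eq[of "d - 1" j] by auto
  moreover have "(d - 1) mod j + 1 \<in> {1..j}" using assms(2)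
    by (simp add: Suc_leI)
  ultimately show "\<exists>m\<in>{1..j}. d = (i - 1) * j + m" by blast
qed

lemma cell_offset_le:
  fixes a i j m :: nat
  assumes "i \<in> {1..a}" "m \<in> {1..j}"
  shows "(i - 1) * j + m \<le> j * a"
proof -
  have "(i - 1) * j + m \<le> (i - 1) * j + j" using assms by simp
  also have "\<dots> = i * j" using assms by (cases i) auto
  also have "\<dots> \<le> j * a" using assms by simp
  finally show ?thesis .
qed

text \<open>All offsets \<open>(i - 1) * j + m\<close> lie strictly between 0 and the modulus, so
  the congruence becomes an equation for the residue \<open>d\<close>, and \<open>d = 0\<close>
  means \<open>r = s\<close>.\<close>

lemma join_cell_iff:
  assumes "r \<in> {0..j * a}" "s \<in> {0..j * a}" "i \<in> {1..a}" "0 < j"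
  shows "(\<exists>m\<in>{1..j}. [s = r + (i - 1) * j + m] (mod (j * a + 1))) \<longleftrightarrow> r \<noteq> s \<and> join_cell a j r s = i"
proof -
  define d where "d = (s + (j * a + 1) - r) mod (j * a + 1)"
  have "d = 0 \<longleftrightarrow> r = s"
    using cong_shift_iff[of r "j * a + 1" s 0] assms unfolding d_def
    by (auto simp: cong_def)
  moreover have "(\<exists>m\<in>{1..j}. [s = r + (i - 1) * j + m] (mod (j * a + 1)))
      \<longleftrightarrow> (\<exists>m\<in>{1..j}. d = (i - 1) * j + m)"
  proof (rule bex_cong[OF refl])
    fix m assume "m \<in> {1..j}"
    then have "(i - 1) * j + m < j * a + 1"
      using cell_offset_le[OF assms(3)] by (simp add: less_Suc_eq_le)
    then show "[s = r + (i - 1) * j + m] (mod (j * a + 1)) \<longleftrightarrow> d = (i - 1) * j + m"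
      using cong_shift_iff[of r "j * a + 1" s "(i - 1) * j + m"] assms unfolding d_def
      by (auto simp: add.assoc)
  qed
  ultimately show ?thesis
    using shift_iff_div[of i j d] assms by (auto simp: join_cell_def d_def)
qed

lemma join_cell_in:
  assumes "0 < a" "0 < j"
  shows "join_cell a j r s \<in> {1..a}"
proof -
  have "(s + (j * a + 1) - r) mod (j * a + 1) < j * a + 1" by (rule mod_less_divisor) simp
  moreover have "0 < a * j" using assms by simp
  ultimately have "(s + (j * a + 1) - r) mod (j * a + 1) - 1 < a * j"
    unfolding mult.commute[of a j] by linarith
  then have "((s + (j * a + 1) - r) mod (j * a + 1) - 1) div j < a"
    by (rule less_mult_imp_div_less)
  then show ?thesis by (simp add: join_cell_def)
qed

text \<open>For fixed \<open>s\<close>, each \<open>m\<close> in \<open>1..j\<close> comes from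
  exactly one source layer \<open>g m\<close>, and distinct \<open>m\<close> give distinct
  layers.\<close>

lemma card_join_cell:
  assumes s: "s \<in> {0..j * a}" and i: "i \<in> {1..a}" and j: "0 < j"
  shows "card {r \<in> {0..j * a} - {s}. join_cell a j r s = i} = j"
proof -
  define N where "N = j * a + 1"
  define g where "g m = (s + N - ((i - 1) * j + m)) mod N" for m
  have lt: "(i - 1) * j + m < N" if "m \<in> {1..j}" for m
    using cell_offset_le[OF i that] by (simp add: N_def)
  have g_iff: "[s = r + (i - 1) * j + m] (mod N) \<longleftrightarrow> r = g m"
    if "m \<in> {1..j}" "r \<in> {0..j * a}" for m r
    using cong_shift_iff[OF lt[OF that(1)], of s r] s that unfolding g_def
    by (simp add: N_def ac_simps)
  have g_in: "g m \<in> {0..j * a}" for m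
    using mod_less_divisor[of N "s + N - ((i - 1) * j + m)"] unfolding g_def N_def by auto
  have "{r \<in> {0..j * a} - {s}. join_cell a j r s = i} = g ` {1..j}"
    using join_cell_iff[OF _ s i j] g_iff g_in unfolding N_def by blast
  moreover have "inj_on g {1..j}"
  proof (rule inj_onI)
    fix m m' assume m: "m \<in> {1..j}" "m' \<in> {1..j}" "g m = g m'"
    \<comment> \<open>Both sides are congruent to \<open>s\<close>, so the common layer can be
      cancelled.\<close>
    then have "[g m + ((i - 1) * j + m) = g m + ((i - 1) * j + m')] (mod N)"
      using g_iff[OF m(1) g_in, of m] g_iff[OF m(2) g_in, of m]
      by (metis add.assoc cong_sym cong_trans)
    then have "[(i - 1) * j + m = (i - 1) * j + m'] (mod N)"
      by (simp only: cong_add_lcancel_nat)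
    then show "m = m'"
      using cong_less_modulus_unique_nat[OF _ lt[OF m(1)] lt[OF m(2)]] by simp
  qed
  ultimately show ?thesis by (simp add: card_image)
qed

text \<open>Block form of the matrix: off the diagonal blocks the entry does not depend on the
  source vertex \<open>u\<close>, which lets the sums below factor.\<close>

lemma adj_mat_pi_join:
  assumes "u \<in> pverts G" "r \<in> {0..j * a}" "s \<in> {0..j * a}" "0 < a" "0 < j"
  shows "adj_mat (pi_join G a C j) (u, r) (v, s) =
    (if r = s then adj_mat G u v else of_bool (v \<in> C (join_cell a j r s)))"
proof -
  have "((u, r), (v, s)) \<in> parcs (pi_join G a C j) \<longleftrightarrow>
      (u, v) \<in> parcs G \<and> r = s \<or>
      (\<exists>i\<in>{1..a}. v \<in> C i \<and> (\<exists>m\<in>{1..j}. [s = r + (i - 1) * j + m] (mod (j * a + 1))))"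
    using assms unfolding pi_join_def by auto
  also have "\<dots> \<longleftrightarrow> (u, v) \<in> parcs G \<and> r = s \<or>
      (\<exists>i\<in>{1..a}. v \<in> C i \<and> r \<noteq> s \<and> join_cell a j r s = i)"
    using join_cell_iff[OF assms(2,3) _ assms(5)] by auto
  also have "\<dots> \<longleftrightarrow> (if r = s then (u, v) \<in> parcs G else v \<in> C (join_cell a j r s))"
    using join_cell_in[OF assms(4,5), of r s] by auto
  finally show ?thesis unfolding adj_mat_def by auto
qed

text \<open>No loops arise: arcs inside a layer come from \<open>G\<close>, and all others change
  the layer.\<close>

lemma pair_digraph_pi_join:
  assumes "pair_digraph G" and C: "\<And>i. i \<in> {1..a} \<Longrightarrow> C i \<subseteq> pverts G" and "0 < j"
  shows "pair_digraph (pi_join G a C j)"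
proof -
  interpret pair_digraph G by fact
  let ?H = "pi_join G a C j"
  have wf: "fst e \<in> pverts ?H \<and> snd e \<in> pverts ?H" if "e \<in> parcs ?H" for e
    using that subsetD[OF C] unfolding pi_join_def by (auto dest: in_arcsD1 in_arcsD2)
  have fin: "finite (pverts ?H)" unfolding pi_join_def by simp
  have "fst e \<noteq> snd e" if e: "e \<in> parcs ?H" for e
  proof -
    obtain u r v s where eq: "e = ((u, r), (v, s))" by (metis prod.exhaust)
    have H: "(u, v) \<in> parcs G \<and> r = s \<or>
      (\<exists>i\<in>{1..a}. \<exists>m\<in>{1..j}. [s = r + (i - 1) * j + m] (mod (j * a + 1)))"
      using e unfolding pi_join_def eq by auto
    have rs: "r \<in> {0..j * a}" "s \<in> {0..j * a}"
      using wf[OF e] unfolding pi_join_def eq by auto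
    from H show ?thesis
      using no_loops join_cell_iff[OF rs _ \<open>0 < j\<close>] eq by fastforce
  qed
  moreover have "finite (parcs ?H)"
    by (rule finite_subset[of _ "pverts ?H \<times> pverts ?H"]) (use wf fin in \<open>auto simp: mem_Times_iff\<close>)
  ultimately show ?thesis
    using wf fin by unfold_locales auto
qed

theorem theorem2:
  fixes G :: "'v pair_pre_digraph" and n k t lam mu a b j :: nat and C :: "nat \<Rightarrow> 'v set"
  assumes "dsrg G n k t lam mu"
    and "a \<ge> 1" and "b \<ge> 1" and "a * b = n"
    and "homogeneous_partition G a b C"
    and "column_equitable G a C
           (\<lambda>i l. (int lam + int b - int k) * id_mat i l + int mu * (ones_mat i l - id_mat i l))"
    and "j \<ge> 1"
  shows "dsrg (pi_join G a C j)
           ((j * a + 1) * n) (j * n + k) (j * b + t) (j * b + lam) (j * b + mu)"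
proof -
  define V where "V = pverts G"
  define R where "R = {0..j * a}"
  define A where "A = adj_mat G"
  define B where "B = adj_mat (pi_join G a C j)"
  define f where "f = join_cell a j"
  define \<chi> :: "nat \<Rightarrow> 'v \<Rightarrow> int" where "\<chi> i v = of_bool (v \<in> C i)" for i v
  have dg: "pair_digraph G" and cardV: "card V = n"
    using assms(1) by (auto simp: dsrg_def V_def)
  interpret pair_digraph G by fact
  have finV: "finite V" and finR: "finite R" by (auto simp: V_def R_def)
  have rowA: "(\<Sum>v\<in>V. A u v) = k" if "u \<in> V" for u
    using assms(1) that by (auto simp: dsrg_def V_def A_def Let_def mat_mul_def ones_mat_def)
  have colA: "(\<Sum>u\<in>V. A u v) = k" if "v \<in> V" for v
    using assms(1) that by (auto simp: dsrg_def V_def A_def Let_def mat_mul_def ones_mat_def)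
  have sqA: "(\<Sum>v\<in>V. A u v * A v w) =
      int t * id_mat u w + int lam * A u w + int mu * (1 - id_mat u w - A u w)"
    if "u \<in> V" "w \<in> V" for u w
    using assms(1) that by (auto simp: dsrg_def V_def A_def Let_def mat_mul_def ones_mat_def)
  have part: "partition_on V (C ` {1..a})" "inj_on C {1..a}"
    and cardC: "\<And>i. i \<in> {1..a} \<Longrightarrow> card (C i) = b"
    using assms(5) by (auto simp: homogeneous_partition_def V_def)
  have CV: "C i \<subseteq> V" if "i \<in> {1..a}" for i
    using that partition_onD1[OF part(1)] by auto
  have cell: "\<exists>l\<in>{1..a}. w \<in> C l" if "w \<in> V" for w
    using that partition_onD1[OF part(1)] by auto
  have cell_unique: "i = l" if "i \<in> {1..a}" "l \<in> {1..a}" "w \<in> C i" "w \<in> C l" for i l w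
  proof -
    have "C i = C l"
      using disjointD[OF partition_onD2[OF part(1)], of "C i" "C l"] that by blast
    then show ?thesis using inj_onD[OF part(2)] that by blast
  qed
  have f_in: "f r s \<in> {1..a}" for r s
    unfolding f_def using join_cell_in assms(2,7) by simp
  have sum_\<chi>: "(\<Sum>v\<in>V. \<chi> i v * g v) = (\<Sum>v\<in>C i. g v)" if "i \<in> {1..a}" for i and g :: "'v \<Rightarrow> int"
    unfolding \<chi>_def using CV[OF that] finV
    by (simp add: of_bool_def if_distrib[of "\<lambda>x. x * _"] sum.If_cases Int_absorb1 cong: if_cong)
  have sum_\<chi>1: "(\<Sum>v\<in>V. \<chi> i v) = b" if "i \<in> {1..a}" for i
    using sum_\<chi>[OF that, of "\<lambda>_. 1"] cardC[OF that] by simp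
  have \<chi>_cell: "\<chi> i w = of_bool (i = l)" if "i \<in> {1..a}" "l \<in> {1..a}" "w \<in> C l" for i l w
    unfolding \<chi>_def using cell_unique that by auto
  \<comment> \<open>As \<open>w\<close> lies in exactly one cell \<open>l\<close>, the sum counts
    the layers that send arcs into \<open>C l\<close>.\<close>
  have sum_layers: "(\<Sum>s\<in>R - {r}. \<chi> (f s r) w) = j" if "r \<in> R" "w \<in> V" for r w
  proof -
    obtain l where l: "l \<in> {1..a}" "w \<in> C l" using cell[OF \<open>w \<in> V\<close>] by blast
    have "(\<Sum>s\<in>R - {r}. \<chi> (f s r) w) = (\<Sum>s\<in>R - {r}. of_bool (f s r = l))"
      using \<chi>_cell[OF f_in l] by simp
    also have "\<dots> = int (card {s \<in> R - {r}. f s r = l})"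
      using finR by (simp add: of_bool_def sum.If_cases Int_def)
    also have "\<dots> = j"
      using card_join_cell[of r j a l] that(1) l(1) assms(7) by (simp add: f_def R_def)
    finally show ?thesis .
  qed
  have Q: "(\<Sum>v\<in>V. \<chi> i v * A v w) = (if w \<in> C i then int lam + int b - int k else int mu)"
    if i: "i \<in> {1..a}" and "w \<in> V" for i w
  proof -
    obtain l where l: "l \<in> {1..a}" "w \<in> C l" using cell[OF \<open>w \<in> V\<close>] by blast
    have "(\<Sum>v\<in>C i. A v w) = int (card {v \<in> C i. (v, w) \<in> parcs G})"
      using finite_subset[OF CV[OF i] finV] by (simp add: A_def adj_mat_def sum.If_cases Int_def)
    also have "\<dots> = (int lam + int b - int k) * id_mat i l + int mu * (ones_mat i l - id_mat i l)"
      using assms(6) i l unfolding column_equitable_def by blast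
    also have "\<dots> = (if w \<in> C i then int lam + int b - int k else int mu)"
      using \<chi>_cell[OF i l] by (cases "i = l") (simp_all add: id_mat_def ones_mat_def \<chi>_def)
    finally show ?thesis by (simp add: sum_\<chi>[OF i])
  qed
  have B_eq: "B (u, r) (v, s) = (if r = s then A u v else \<chi> (f r s) v)"
    if "u \<in> V" "r \<in> R" "s \<in> R" for u r v s
    using adj_mat_pi_join[of u G r j a s C v] that assms(2,7)
    by (simp add: B_def A_def V_def R_def f_def \<chi>_def)
  have split_sum: "(\<Sum>z\<in>V \<times> R. g z) = (\<Sum>v\<in>V. g (v, r)) + (\<Sum>s\<in>R - {r}. \<Sum>v\<in>V. g (v, s))"
    if "r \<in> R" for g :: "'v \<times> nat \<Rightarrow> int" and r
  proof -
    have "(\<Sum>z\<in>V \<times> R. g z) = (\<Sum>s\<in>R. \<Sum>v\<in>V. g (v, s))"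
      by (subst sum.swap) (simp add: sum.cartesian_product)
    then show ?thesis using sum.remove[OF finR that] by simp
  qed
  have cardR: "card (R - {r}) = j * a" if "r \<in> R" for r
    using that by (simp add: R_def)
  have rowB: "(\<Sum>z\<in>V \<times> R. B (u, r) z) = j * n + k" if "u \<in> V" "r \<in> R" for u r
  proof -
    \<comment> \<open>Each of the \<open>j * a\<close> other layers receives \<open>b\<close> arcs,
      and \<open>j * a * b = j * n\<close>.\<close>
    have "(\<Sum>s\<in>R - {r}. \<Sum>v\<in>V. B (u, r) (v, s)) = (\<Sum>s\<in>R - {r}. int b)"
      using that sum_\<chi>1[OF f_in] by (intro sum.cong) (auto simp: B_eq)
    then show ?thesis
      unfolding split_sum[OF that(2)] using that rowA cardR assms(4)[symmetric] by (simp add: B_eq)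
  qed
  have colB: "(\<Sum>z\<in>V \<times> R. B z (w, s)) = j * n + k" if "w \<in> V" "s \<in> R" for w s
  proof -
    have "(\<Sum>r\<in>R - {s}. \<Sum>v\<in>V. B (v, r) (w, s)) = (\<Sum>r\<in>R - {s}. n * \<chi> (f r s) w)"
      using that cardV by (intro sum.cong) (auto simp: B_eq)
    also have "\<dots> = n * j"
      using sum_layers[OF that(2,1)] by (simp flip: sum_distrib_left)
    finally show ?thesis
      unfolding split_sum[OF that(2)] using that colA by (simp add: B_eq)
  qed
  have sqB: "(\<Sum>z\<in>V \<times> R. B (u, r) z * B z (w, s)) =
      int (j * b + t) * id_mat (u, r) (w, s) + int (j * b + lam) * B (u, r) (w, s) +
      int (j * b + mu) * (1 - id_mat (u, r) (w, s) - B (u, r) (w, s))"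
    if u: "u \<in> V" and w: "w \<in> V" and r: "r \<in> R" and s: "s \<in> R" for u w r s
  proof -
    \<comment> \<open>Only the first factor depends on \<open>v\<close>, and it sums to a cell
      size.\<close>
    have other: "(\<Sum>v\<in>V. B (u, r) (v, q) * B (v, q) (w, s)) = b * \<chi> (f q s) w"
      if "q \<in> R" "q \<noteq> r" "q \<noteq> s" for q
      using that u r s sum_\<chi>1[OF f_in] by (simp add: B_eq flip: sum_distrib_right)
    show ?thesis
    proof (cases "r = s")
      case True
      have "(\<Sum>q\<in>R - {r}. \<Sum>v\<in>V. B (u, r) (v, q) * B (v, q) (w, s)) = b * j"
        using other True sum_layers[OF s w] by (simp flip: sum_distrib_left)
      \<comment> \<open>Layer \<open>r\<close> contributes the entry of the square of
        \<open>A\<close>; the constant \<open>b * j\<close> raises \<open>t\<close>,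
        \<open>lam\<close> and \<open>mu\<close> alike because their three coefficients add up to
        1.\<close>
      then show ?thesis
        unfolding split_sum[OF r] using True u w s sqA[OF u w]
        by (simp add: B_eq id_mat_def algebra_simps)
    next
      case False
      have rs: "r \<in> R - {s}" using r False by simp
      \<comment> \<open>Layer \<open>s\<close> is removed first because \<open>sum_layers\<close>
        already excludes it; then layer \<open>r\<close> is taken out.\<close>
      have "(\<Sum>q\<in>R - {s} - {r}. \<chi> (f q s) w) = j - \<chi> (f r s) w"
        using sum_layers[OF s w] sum.remove[OF _ rs, of "\<lambda>q. \<chi> (f q s) w"] finR by simp
      then have "(\<Sum>q\<in>R - {s} - {r}. \<Sum>v\<in>V. B (u, r) (v, q) * B (v, q) (w, s)) =
          b * (j - \<chi> (f r s) w)"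
        using other by (simp flip: sum_distrib_left)
      moreover have "(\<Sum>v\<in>V. B (u, r) (v, r) * B (v, r) (w, s)) = k * \<chi> (f r s) w"
        using u r s False rowA[OF u] by (simp add: B_eq flip: sum_distrib_right)
      moreover have "(\<Sum>v\<in>V. B (u, r) (v, s) * B (v, s) (w, s)) =
          (if w \<in> C (f r s) then int lam + int b - int k else int mu)"
        using u r s False Q[OF f_in w] by (simp add: B_eq)
      ultimately have "(\<Sum>z\<in>V \<times> R. B (u, r) z * B z (w, s)) =
          (if w \<in> C (f r s) then int lam + int b - int k else int mu) +
          (k * \<chi> (f r s) w + b * (j - \<chi> (f r s) w))"
        unfolding split_sum[OF s] sum.remove[OF finite_Diff[OF finR] rs] by (simp only:)
      moreover have "B (u, r) (w, s) = \<chi> (f r s) w" "id_mat (u, r) (w, s) = 0"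
        using u r s False by (simp_all add: B_eq id_mat_def)
      \<comment> \<open>If \<open>w\<close> is in the cell,
        \<open>(lam + b - k) + k + b * (j - 1) = j * b + lam\<close>; otherwise the total is
        \<open>mu + b * j\<close>.\<close>
      ultimately show ?thesis
        by (cases "w \<in> C (f r s)") (simp_all add: \<chi>_def algebra_simps)
    qed
  qed
  have "\<forall>x\<in>V \<times> R. \<forall>y\<in>V \<times> R.
      (\<Sum>z\<in>V \<times> R. B x z * 1) = int (j * n + k) * 1 \<and>
      (\<Sum>z\<in>V \<times> R. 1 * B z y) = int (j * n + k) * 1 \<and>
      (\<Sum>z\<in>V \<times> R. B x z * B z y) =
        int (j * b + t) * id_mat x y + int (j * b + lam) * B x y +
        int (j * b + mu) * (1 - id_mat x y - B x y)"
    unfolding mult_1_left mult_1_right using rowB colB sqB by (clarsimp simp del: of_nat_add of_nat_mult)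
  moreover have "card (V \<times> R) = (j * a + 1) * n"
    using cardV by (simp add: R_def card_cartesian_product)
  moreover have "pverts (pi_join G a C j) = V \<times> R" by (simp add: pi_join_def V_def R_def)
  moreover have "pair_digraph (pi_join G a C j)"
    by (rule pair_digraph_pi_join[OF dg]) (use CV assms(7) in \<open>auto simp: V_def\<close>)
  ultimately show ?thesis
    unfolding dsrg_def Let_def mat_mul_def B_def ones_mat_def by (simp only:)
qed

end
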